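(* For $P_1,P_2\in\mathfrak{P}_1$, one has $P_1=P_2$ if and only if $\mathcal{Z}(P_1)=\mathcal{Z}(P_2)$.
   Context: $\mathbb{D}=\{z\in\mathbb{C}:|z|<1\}$ is the open unit disk and $\mathcal{O}(\mathbb{D})$ is the ring of holomorphic functions on $\mathbb{D}$. $\mathcal{R}_{\mathbb{R}}=\mathbb{Z}[[z]]\cap\mathcal{O}(\mathbb{D})$ is the ring of holomorphic functions on $\mathbb{D}$ all of whose Taylor coefficients at $0$ are integers. $\mathfrak{P}_1$ is the set of prime ideals of $\mathcal{R}_{\mathbb{R}}$ containing at least one element of the form $1+zF$ with $F\in\mathcal{R}_{\mathbb{R}}$. For $P\in\mathfrak{P}_1$, the analytic invariant is $\mathcal{Z}(P)=\{Z(f): f\in P,\ f=1+zF \text{ for some } F\in\mathcal{R}_{\mathbb{R}}\}$, where $Z(f)$ denotes the zero set of $f$ in $\mathbb{D}$ counted with multiplicities (the zero divisor of $f$). *)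

theory Defs
  imports "HOL-Complex_Analysis.Complex_Analysis" "HOL-Algebra.Ideal"
begin

abbreviation unit_disk :: "complex set"  ("\<bbbD>")
  where "\<bbbD> \<equiv> ball 0 1"

(* A function on the disk is represented by its extensional extension to the whole plane
   (constantly undefined off the disk), so that equality in the ring is equality on the disk. *)
definition RR :: "(complex \<Rightarrow> complex) ring" where
  "RR = \<lparr>carrier = {f \<in> extensional \<bbbD>. f holomorphic_on \<bbbD> \<and>
                      (\<forall>n. fps_nth (fps_expansion f 0) n \<in> \<int>)},
         mult = (\<lambda>f g. \<lambda>z\<in>\<bbbD>. f z * g z),
         one = (\<lambda>z\<in>\<bbbD>. 1),
         zero = (\<lambda>z\<in>\<bbbD>. 0),
         add = (\<lambda>f g. \<lambda>z\<in>\<bbbD>. f z + g z)\<rparr>"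

definition coord :: "complex \<Rightarrow> complex" where
  "coord = (\<lambda>z\<in>\<bbbD>. z)"

definition one_plus_zRR :: "(complex \<Rightarrow> complex) set" where
  "one_plus_zRR = {\<one>\<^bsub>RR\<^esub> \<oplus>\<^bsub>RR\<^esub> coord \<otimes>\<^bsub>RR\<^esub> F | F. F \<in> carrier RR}"

definition primes1 :: "(complex \<Rightarrow> complex) set set"  ("\<PP>\<^sub>1") where
  "\<PP>\<^sub>1 = {P. primeideal P RR \<and> P \<inter> one_plus_zRR \<noteq> {}}"

(* The order of vanishing at each point of the disk.  Only meaningful for functions that are not
   identically zero; elements of one_plus_zRR take the value 1 at the origin. *)
definition zero_divisor :: "(complex \<Rightarrow> complex) \<Rightarrow> complex \<Rightarrow> nat" where
  "zero_divisor f z = (if z \<in> \<bbbD> \<and> f z = 0 then nat (zorder f z) else 0)"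

definition analytic_invariant :: "(complex \<Rightarrow> complex) set \<Rightarrow> (complex \<Rightarrow> nat) set"  ("\<Z>") where
  "\<Z> P = {zero_divisor f | f. f \<in> P \<and> f \<in> one_plus_zRR}"

lemma RR_carrier_iff:
  "f \<in> carrier RR \<longleftrightarrow> f \<in> extensional \<bbbD> \<and> f holomorphic_on \<bbbD> \<and>
     (\<exists>F. f has_fps_expansion F \<and> (\<forall>n. fps_nth F n \<in> \<int>))"
proof -
  have "f has_fps_expansion fps_expansion f 0" if "f holomorphic_on \<bbbD>"
    using that by (intro has_fps_expansion_fps_expansion[of \<bbbD>]) auto
  then show ?thesis
    using fps_expansion_unique_complex by (auto simp: RR_def)
qed

lemma restrict_in_RR:
  assumes "f holomorphic_on \<bbbD>" "f has_fps_expansion F" "\<And>n. fps_nth F n \<in> \<int>"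
  shows "restrict f \<bbbD> \<in> carrier RR"
proof -
  have "eventually (\<lambda>z. restrict f \<bbbD> z = f z) (nhds 0)"
    by (rule eventually_mono[OF eventually_nhds_in_open[of \<bbbD>]]) auto
  then have "restrict f \<bbbD> has_fps_expansion F"
    using assms(2) has_fps_expansion_cong by blast
  moreover have "restrict f \<bbbD> holomorphic_on \<bbbD>"
    using assms(1) by (rule holomorphic_transform) auto
  ultimately show ?thesis
    using assms(3) by (auto simp: RR_carrier_iff)
qed

lemma coord_in_RR: "coord \<in> carrier RR"
  unfolding coord_def
proof (rule restrict_in_RR)
  show "(\<lambda>z::complex. z) has_fps_expansion fps_X"
    by (rule has_fps_expansion_fps_X)
qed (simp_all add: fps_X_def)

lemma cring_RR: "cring RR"
proof (rule cringI)
  have holo: "f holomorphic_on \<bbbD>" if "f \<in> carrier RR" for f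
    using that unfolding RR_carrier_iff by blast
  have add: "(\<lambda>z\<in>\<bbbD>. f z + g z) \<in> carrier RR" if fg: "f \<in> carrier RR" "g \<in> carrier RR" for f g
  proof -
    obtain F G where F: "f has_fps_expansion F" "\<And>n. fps_nth F n \<in> \<int>"
      and G: "g has_fps_expansion G" "\<And>n. fps_nth G n \<in> \<int>"
      using fg unfolding RR_carrier_iff by blast
    show ?thesis
    proof (rule restrict_in_RR)
      show "(\<lambda>z. f z + g z) holomorphic_on \<bbbD>"
        using fg by (intro holomorphic_on_add holo)
      show "(\<lambda>z. f z + g z) has_fps_expansion F + G"
        using F(1) G(1) by (rule has_fps_expansion_add)
    qed (use F(2) G(2) in simp)
  qed
  have neg: "(\<lambda>z\<in>\<bbbD>. - f z) \<in> carrier RR" if f: "f \<in> carrier RR" for f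
  proof -
    obtain F where F: "f has_fps_expansion F" "\<And>n. fps_nth F n \<in> \<int>"
      using f unfolding RR_carrier_iff by blast
    show ?thesis
    proof (rule restrict_in_RR)
      show "(\<lambda>z. - f z) holomorphic_on \<bbbD>"
        using f by (intro holomorphic_on_minus holo)
      show "(\<lambda>z. - f z) has_fps_expansion - F"
        using F(1) by (rule has_fps_expansion_minus)
    qed (use F(2) in simp)
  qed
  have mult: "(\<lambda>z\<in>\<bbbD>. f z * g z) \<in> carrier RR" if fg: "f \<in> carrier RR" "g \<in> carrier RR" for f g
  proof -
    obtain F G where F: "f has_fps_expansion F" "\<And>n. fps_nth F n \<in> \<int>"
      and G: "g has_fps_expansion G" "\<And>n. fps_nth G n \<in> \<int>"
      using fg unfolding RR_carrier_iff by blast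
    show ?thesis
    proof (rule restrict_in_RR)
      show "(\<lambda>z. f z * g z) holomorphic_on \<bbbD>"
        using fg by (intro holomorphic_on_mult holo)
      show "(\<lambda>z. f z * g z) has_fps_expansion F * G"
        using F(1) G(1) by (rule has_fps_expansion_mult)
      show "fps_nth (F * G) n \<in> \<int>" for n
        unfolding fps_mult_nth by (intro Ints_sum Ints_mult F(2) G(2))
    qed
  qed
  have zero: "(\<lambda>z\<in>\<bbbD>. 0) \<in> carrier RR"
    by (rule restrict_in_RR[where F = 0]) auto
  have one: "(\<lambda>z\<in>\<bbbD>. 1) \<in> carrier RR"
    by (rule restrict_in_RR[where F = 1]) auto
  have ext: "f \<in> extensional \<bbbD>" if "f \<in> carrier RR" for f
    using that by (simp add: RR_carrier_iff)
  have ops: "x \<otimes>\<^bsub>RR\<^esub> y = (\<lambda>z\<in>\<bbbD>. x z * y z)" "x \<oplus>\<^bsub>RR\<^esub> y = (\<lambda>z\<in>\<bbbD>. x z + y z)"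
    "\<one>\<^bsub>RR\<^esub> = (\<lambda>z\<in>\<bbbD>. 1)" "\<zero>\<^bsub>RR\<^esub> = (\<lambda>z\<in>\<bbbD>. 0)" for x y
    by (simp_all add: RR_def)
  have ext_eq: "(\<lambda>z\<in>\<bbbD>. f z) = g" if "g \<in> carrier RR" "\<And>z. z \<in> \<bbbD> \<Longrightarrow> f z = g z" for f g
    using that ext by (intro extensionalityI[where A = \<bbbD>]) simp_all
  show "abelian_group RR"
  proof (rule abelian_groupI)
    fix x assume x: "x \<in> carrier RR"
    show "\<exists>y\<in>carrier RR. y \<oplus>\<^bsub>RR\<^esub> x = \<zero>\<^bsub>RR\<^esub>"
      by (rule bexI[OF _ neg[OF x]]) (simp add: ops restrict_def fun_eq_iff)
    show "\<zero>\<^bsub>RR\<^esub> \<oplus>\<^bsub>RR\<^esub> x = x"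
      unfolding ops using x by (intro ext_eq) simp_all
  qed (simp_all add: ops add zero add_ac cong: restrict_cong)
  show "comm_monoid RR"
  proof (rule comm_monoidI)
    fix x assume x: "x \<in> carrier RR"
    show "\<one>\<^bsub>RR\<^esub> \<otimes>\<^bsub>RR\<^esub> x = x"
      unfolding ops using x by (intro ext_eq) simp_all
  qed (simp_all add: ops mult one mult_ac cong: restrict_cong)
  show "(x \<oplus>\<^bsub>RR\<^esub> y) \<otimes>\<^bsub>RR\<^esub> z = x \<otimes>\<^bsub>RR\<^esub> z \<oplus>\<^bsub>RR\<^esub> y \<otimes>\<^bsub>RR\<^esub> z" for x y z
    by (simp add: ops restrict_def fun_eq_iff distrib_right)
qed

end

theory Submission
  imports Defs
begin

text \<open>
  Call an element of the form \<open>1 + z F\<close> normalized.  The invariant remembers a normalized element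
  up to a unit.  Indeed, if \<open>f\<close> and \<open>g\<close>
  are normalized and have the same zero divisor, then each quotient \<open>f / g\<close> and \<open>g / f\<close> extends
  holomorphically to the disk, and its Taylor coefficients are again integers because a power series
  with integer coefficients and constant term \<open>1\<close> can be inverted over the integers.  So \<open>f\<close>
  and \<open>g\<close> divide each other in \<open>RR\<close> (lemma \<open>RR_divides_if_zero_divisor_le\<close>), and an ideal that
  contains one of them contains the other.  Hence the invariant of \<open>P\<close> determines which
  normalized elements lie in \<open>P\<close>.

  These elements determine the whole prime ideal, by a translation trick (lemma
  \<open>prime_subset_if_normalized_subset\<close>): fix \<open>f = 1 + z F\<close> in \<open>P\<close> and let \<open>h\<close> be any
  element of \<open>P\<close>.  Then \<open>f + z h\<close> lies in \<open>P\<close> and is again normalized.  If another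
  prime ideal contains \<open>f\<close> and \<open>f + z h\<close>, it contains \<open>z h\<close>.  It cannot contain \<open>z\<close>, since
  together with \<open>1 + z F\<close> this would put \<open>1\<close> into it; so it contains \<open>h\<close>.
\<close>

section \<open>Division of holomorphic functions\<close>

text \<open>
  The quotient \<open>f / g\<close> has at worst isolated singularities, and near a point \<open>z\<close> the local
  factorizations of \<open>f\<close> and \<open>g\<close> show that it behaves like a holomorphic function times
  a nonnegative power of \<open>w - z\<close>.  So every singularity is removable.
\<close>

lemma holomorphic_divides_if_zorder_le:
  assumes f: "f holomorphic_on S" and g: "g holomorphic_on S"
    and S: "open S" "connected S"
    and nz: "\<exists>w\<in>S. f w \<noteq> 0" "\<exists>w\<in>S. g w \<noteq> 0"
    and le: "\<And>z. z \<in> S \<Longrightarrow> zorder g z \<le> zorder f z"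
  obtains u where "u holomorphic_on S" "\<And>z. z \<in> S \<Longrightarrow> f z = g z * u z"
proof -
  define h where "h = (\<lambda>w. f w / g w)"
  define u where "u = remove_sings h"
  have local: "u analytic_on {z} \<and> f z = g z * u z" if z: "z \<in> S" for z
  proof -
    define p q where "p = zor_poly f z" and "q = zor_poly g z"
    define n m where "n = zorder f z" and "m = zorder g z"
    obtain r where r: "r > 0" "p holomorphic_on cball z r"
        "\<And>w. w \<in> cball z r \<Longrightarrow> f w = p w * (w - z) ^ nat n"
      using conjunct2[OF zorder_exist_zero[OF f S z nz(1)]] unfolding p_def n_def by blast
    obtain s where s: "s > 0" "q holomorphic_on cball z s"
        "\<And>w. w \<in> cball z s \<Longrightarrow> g w = q w * (w - z) ^ nat m \<and> q w \<noteq> 0"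
      using conjunct2[OF zorder_exist_zero[OF g S z nz(2)]] unfolding q_def m_def by blast
    define t where "t = min r s"
    have t: "t > 0" "ball z t \<subseteq> cball z r" "ball z t \<subseteq> cball z s"
      using r(1) s(1) by (auto simp: t_def)
    define k where "k = (\<lambda>w. p w / q w * (w - z) ^ (nat n - nat m))"
    have k_holo: "k holomorphic_on ball z t"
      unfolding k_def using s(3) t(3)
      by (intro holomorphic_intros holomorphic_on_subset[OF r(2) t(2)]
          holomorphic_on_subset[OF s(2) t(3)]) blast
    have h_eq_k: "h w = k w" if w: "w \<in> ball z t - {z}" for w
    proof -
      have "nat m \<le> nat n"
        using le[OF z] by (simp add: m_def n_def nat_mono)
      then have "(w - z) ^ nat n = (w - z) ^ nat m * (w - z) ^ (nat n - nat m)"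
        by (simp flip: power_add)
      moreover have "f w = p w * (w - z) ^ nat n" "g w = q w * (w - z) ^ nat m" "q w \<noteq> 0"
        using r(3)[of w] s(3)[of w] t w by auto
      ultimately show ?thesis
        using w by (simp add: h_def k_def)
    qed
    have punctured: "\<forall>\<^sub>F w in at z. w \<in> ball z t - {z}"
      using t(1) by (intro eventually_at_in_open) auto
    have "k \<midarrow>z\<rightarrow> k z"
      using holomorphic_on_imp_continuous_on[OF k_holo] t(1)
      by (simp add: continuous_on_eq_continuous_at isContD)
    then have lim: "h \<midarrow>z\<rightarrow> k z"
      by (rule Lim_transform_eventually) (use punctured in eventually_elim, use h_eq_k in simp)
    have "h holomorphic_on ball z t - {z}"
      by (rule holomorphic_transform[OF holomorphic_on_subset[OF k_holo Diff_subset]])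
        (simp add: h_eq_k)
    then have "isolated_singularity_at h z"
      using t(1) by (intro isolated_singularity_at_holomorphic[of _ "ball z t"]) auto
    then have ana: "u analytic_on {z}"
      unfolding u_def using lim by (rule remove_sings_analytic_at)
    have u_z: "u z = k z"
      unfolding u_def using lim by (rule remove_sings_eqI)
    \<comment> \<open>The identity at \<open>z\<close> itself follows from the one nearby by continuity.\<close>
    have "isCont g z" "isCont f z"
      using holomorphic_on_imp_continuous_on[OF g] holomorphic_on_imp_continuous_on[OF f] S(1) z
      by (simp_all add: continuous_on_eq_continuous_at)
    then have cont: "g \<midarrow>z\<rightarrow> g z" "f \<midarrow>z\<rightarrow> f z"
      by (auto dest: isContD)
    have "(\<lambda>w. g w * h w) \<midarrow>z\<rightarrow> g z * u z"
      unfolding u_z by (intro tendsto_mult cont lim)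
    moreover have "\<forall>\<^sub>F w in at z. g w * h w = f w"
      using punctured
    proof eventually_elim
      case (elim w)
      then have "g w \<noteq> 0"
        using s(3)[of w] t(3) by auto
      then show ?case
        by (simp add: h_def)
    qed
    ultimately have "f \<midarrow>z\<rightarrow> g z * u z"
      by (rule Lim_transform_eventually)
    then show ?thesis
      using ana LIM_unique[OF cont(2)] by blast
  qed
  then have "u analytic_on S"
    using analytic_on_analytic_at by blast
  then show ?thesis
    using local by (intro that[of u] analytic_imp_holomorphic) auto
qed

text \<open>
  Since \<open>G\<close> has constant term \<open>1\<close>, comparing coefficients in \<open>F = G * U\<close> expresses each coefficient
  of \<open>U\<close> through earlier ones without any division.
\<close>

lemma fps_quotient_in_Ints:
  fixes F G U :: "'a :: comm_ring_1 fps"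
  assumes F: "\<And>n. fps_nth F n \<in> \<int>" and G: "\<And>n. fps_nth G n \<in> \<int>" "fps_nth G 0 = 1"
    and FGU: "F = G * U"
  shows "fps_nth U n \<in> \<int>"
proof (induction n rule: less_induct)
  case (less n)
  have "fps_nth F n = (\<Sum>i=0..n. fps_nth G i * fps_nth U (n - i))"
    by (simp add: FGU fps_mult_nth)
  also have "\<dots> = fps_nth U n + (\<Sum>i=Suc 0..n. fps_nth G i * fps_nth U (n - i))"
    by (simp add: sum.atLeast_Suc_atMost G(2))
  finally have "fps_nth U n = fps_nth F n - (\<Sum>i=Suc 0..n. fps_nth G i * fps_nth U (n - i))"
    by simp
  also have "\<dots> \<in> \<int>"
    by (intro Ints_diff Ints_sum Ints_mult F G less) auto
  finally show ?case .
qed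

section \<open>Divisibility in the ring\<close>

lemma RR_ops:
  "x \<otimes>\<^bsub>RR\<^esub> y = (\<lambda>z\<in>\<bbbD>. x z * y z)" "x \<oplus>\<^bsub>RR\<^esub> y = (\<lambda>z\<in>\<bbbD>. x z + y z)" "\<one>\<^bsub>RR\<^esub> = (\<lambda>z\<in>\<bbbD>. 1)"
  by (simp_all add: RR_def)

lemma one_plus_zRR_carrier: "f \<in> one_plus_zRR \<Longrightarrow> f \<in> carrier RR"
proof -
  interpret cring RR by (rule cring_RR)
  show "f \<in> one_plus_zRR \<Longrightarrow> f \<in> carrier RR"
    unfolding one_plus_zRR_def using coord_in_RR by blast
qed

lemma one_plus_zRR_at_0: "f \<in> one_plus_zRR \<Longrightarrow> f 0 = 1"
  by (auto simp: one_plus_zRR_def RR_ops coord_def)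

text \<open>
  At a point of the disk where \<open>f\<close> does not vanish the order is \<open>0\<close>, so that
  the case distinction in \<open>zero_divisor\<close> disappears.
\<close>

lemma zorder_eq_zero_divisor:
  assumes "f holomorphic_on \<bbbD>" "\<exists>w\<in>\<bbbD>. f w \<noteq> 0" "z \<in> \<bbbD>"
  shows "zorder f z = int (zero_divisor f z)"
  using zorder_exist_zero[OF assms(1) _ _ assms(3,2)] assms(3)
  by (auto simp: zero_divisor_def split: if_splits)

text \<open>
  The inequality of divisors makes the quotient holomorphic; the normalization \<open>g = 1 + z G\<close> makes
  its Taylor coefficients integers.
\<close>

lemma RR_divides_if_zero_divisor_le:
  assumes f: "f \<in> carrier RR" "\<exists>w\<in>\<bbbD>. f w \<noteq> 0" and g: "g \<in> one_plus_zRR"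
    and le: "zero_divisor g \<le> zero_divisor f"
  obtains u where "u \<in> carrier RR" "f = g \<otimes>\<^bsub>RR\<^esub> u"
proof -
  obtain F where F: "f has_fps_expansion F" "\<And>n. fps_nth F n \<in> \<int>"
    and f_holo: "f holomorphic_on \<bbbD>" and f_ext: "f \<in> extensional \<bbbD>"
    using f(1) by (auto simp: RR_carrier_iff)
  obtain G where G: "g has_fps_expansion G" "\<And>n. fps_nth G n \<in> \<int>"
    and g_holo: "g holomorphic_on \<bbbD>"
    using one_plus_zRR_carrier[OF g] by (auto simp: RR_carrier_iff)
  have g0: "g 0 = 1"
    by (rule one_plus_zRR_at_0[OF g])
  then have g_nz: "\<exists>w\<in>\<bbbD>. g w \<noteq> 0"
    by (intro bexI[of _ 0]) auto
  have "zorder g z \<le> zorder f z" if "z \<in> \<bbbD>" for z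
    using le that
    by (simp add: zorder_eq_zero_divisor f_holo f(2) g_holo g_nz le_fun_def)
  then obtain u where u: "u holomorphic_on \<bbbD>" "\<And>z. z \<in> \<bbbD> \<Longrightarrow> f z = g z * u z"
    using holomorphic_divides_if_zorder_le[OF f_holo g_holo _ _ f(2) g_nz] by auto
  define U where "U = fps_expansion u 0"
  have U: "u has_fps_expansion U"
    unfolding U_def using u(1) by (intro has_fps_expansion_fps_expansion[of \<bbbD>]) auto
  have "\<forall>\<^sub>F z in nhds 0. f z = g z * u z"
    by (rule eventually_mono[OF eventually_nhds_in_open[of \<bbbD>]]) (use u(2) in auto)
  then have "f has_fps_expansion G * U"
    using has_fps_expansion_mult[OF G(1) U] by (simp add: has_fps_expansion_cong[OF _ refl])
  then have "F = G * U"
    using F(1) fps_expansion_unique_complex by blast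
  moreover have "fps_nth G 0 = 1"
    using has_fps_expansion_imp_0_eq_fps_nth_0[OF G(1)] g0 by simp
  ultimately have "restrict u \<bbbD> \<in> carrier RR"
    using u(1) U fps_quotient_in_Ints[OF F(2) G(2)] by (intro restrict_in_RR) auto
  moreover have "f = g \<otimes>\<^bsub>RR\<^esub> restrict u \<bbbD>"
    using f_ext u(2) by (intro extensionalityI[where A = \<bbbD>]) (auto simp: RR_ops)
  ultimately show ?thesis
    using that by blast
qed

section \<open>Prime ideals and their normalized elements\<close>

lemma normalized_subset_if_invariant_subset:
  assumes P2: "ideal P2 RR" and sub: "\<Z> P1 \<subseteq> \<Z> P2"
  shows "P1 \<inter> one_plus_zRR \<subseteq> P2"
proof
  interpret P2: ideal P2 RR by (rule P2)
  fix f assume f: "f \<in> P1 \<inter> one_plus_zRR"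
  then have "zero_divisor f \<in> \<Z> P2"
    using sub by (auto simp: analytic_invariant_def)
  then obtain g where g: "g \<in> P2" "g \<in> one_plus_zRR" and eq: "zero_divisor g \<le> zero_divisor f"
    by (auto simp: analytic_invariant_def)
  have "f \<in> carrier RR" "\<exists>w\<in>\<bbbD>. f w \<noteq> 0"
    using f one_plus_zRR_carrier one_plus_zRR_at_0[of f] by (auto intro: bexI[of _ 0])
  then obtain u where "u \<in> carrier RR" "f = g \<otimes>\<^bsub>RR\<^esub> u"
    using g(2) eq by (rule RR_divides_if_zero_divisor_le)
  then show "f \<in> P2"
    using g(1) P2.I_r_closed by blast
qed

lemma coord_notin_prime:
  assumes P: "primeideal P RR" and f: "f \<in> P" "f \<in> one_plus_zRR"
  shows "coord \<notin> P"
proof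
  interpret primeideal P RR by (rule P)
  assume "coord \<in> P"
  obtain F where F: "F \<in> carrier RR" and f_eq: "f = \<one>\<^bsub>RR\<^esub> \<oplus>\<^bsub>RR\<^esub> coord \<otimes>\<^bsub>RR\<^esub> F"
    using f(2) by (auto simp: one_plus_zRR_def)
  have zF: "coord \<otimes>\<^bsub>RR\<^esub> F \<in> P"
    using \<open>coord \<in> P\<close> F by (rule I_r_closed)
  have "\<one>\<^bsub>RR\<^esub> = f \<ominus>\<^bsub>RR\<^esub> coord \<otimes>\<^bsub>RR\<^esub> F"
    unfolding f_eq using coord_in_RR F by algebra
  also have "\<dots> \<in> P"
    unfolding a_minus_def by (intro additive_subgroup.a_closed additive_subgroup.a_inv_closed additive_subgroup_axioms f(1) zF)
  finally show False
    using one_imp_carrier I_notcarr by blast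
qed

text \<open>
  Adding a multiple of \<open>z\<close> does not disturb the normalization, so for \<open>f = 1 + z F\<close> in \<open>P1\<close> every \<open>h\<close>
  in \<open>P1\<close> is visible in the normalized elements, through the difference of \<open>f + z h\<close> and \<open>f\<close>.
\<close>

lemma prime_subset_if_normalized_subset:
  assumes P1: "ideal P1 RR" "P1 \<inter> one_plus_zRR \<noteq> {}" and P2: "primeideal P2 RR"
    and sub: "P1 \<inter> one_plus_zRR \<subseteq> P2"
  shows "P1 \<subseteq> P2"
proof
  interpret P1: ideal P1 RR by (rule P1(1))
  interpret P2: primeideal P2 RR by (rule P2)
  fix h assume h: "h \<in> P1"
  then have h_carr: "h \<in> carrier RR"
    by (rule P1.Icarr)
  obtain f where f: "f \<in> P1" "f \<in> one_plus_zRR"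
    using P1(2) by blast
  then have f_carr: "f \<in> carrier RR" and fP2: "f \<in> P2"
    using sub by (auto intro: one_plus_zRR_carrier)
  obtain F where F: "F \<in> carrier RR" and f_eq: "f = \<one>\<^bsub>RR\<^esub> \<oplus>\<^bsub>RR\<^esub> coord \<otimes>\<^bsub>RR\<^esub> F"
    using f(2) by (auto simp: one_plus_zRR_def)
  define g where "g = f \<oplus>\<^bsub>RR\<^esub> coord \<otimes>\<^bsub>RR\<^esub> h"
  have "g = \<one>\<^bsub>RR\<^esub> \<oplus>\<^bsub>RR\<^esub> coord \<otimes>\<^bsub>RR\<^esub> (F \<oplus>\<^bsub>RR\<^esub> h)"
    unfolding g_def f_eq using coord_in_RR F h_carr by algebra
  then have "g \<in> one_plus_zRR"
    unfolding one_plus_zRR_def using F h_carr by blast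
  moreover have "g \<in> P1"
    unfolding g_def using f(1) h coord_in_RR 
    by (intro additive_subgroup.a_closed P1.additive_subgroup_axioms P1.I_r_closed P1.I_l_closed)
  ultimately have "g \<in> P2"
    using sub by blast
  have "coord \<otimes>\<^bsub>RR\<^esub> h = g \<ominus>\<^bsub>RR\<^esub> f"
    unfolding g_def using coord_in_RR f_carr h_carr by algebra
  also have "\<dots> \<in> P2"
    unfolding a_minus_def by (intro additive_subgroup.a_closed additive_subgroup.a_inv_closed P2.additive_subgroup_axioms
        \<open>g \<in> P2\<close> fP2)
  finally have "coord \<in> P2 \<or> h \<in> P2"
    using P2.I_prime coord_in_RR h_carr by blast
  then show "h \<in> P2"
    using coord_notin_prime[OF P2 fP2 f(2)] by blast
qed

theorem proposition5p6:
  assumes "P1 \<in> \<PP>\<^sub>1" and "P2 \<in> \<PP>\<^sub>1"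
  shows "P1 = P2 \<longleftrightarrow> \<Z> P1 = \<Z> P2"
proof
  have sub: "P \<subseteq> Q" if "P \<in> \<PP>\<^sub>1" "Q \<in> \<PP>\<^sub>1" "\<Z> P = \<Z> Q" for P Q
  proof -
    have P: "ideal P RR" "P \<inter> one_plus_zRR \<noteq> {}" and Q: "primeideal Q RR"
      using that(1,2) by (simp_all add: primes1_def primeideal.axioms(1))
    have "P \<inter> one_plus_zRR \<subseteq> Q"
      using normalized_subset_if_invariant_subset[OF primeideal.axioms(1)[OF Q]] that(3) by simp
    with P Q show ?thesis
      by (rule prime_subset_if_normalized_subset)
  qed
  show "P1 = P2" if "\<Z> P1 = \<Z> P2"
    using sub[OF assms that] sub[OF assms(2,1) that[symmetric]] by (rule equalityI)
qed simp

end
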